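(* Consider a constant-product pool with reserves $R_A,R_B>0$ and pool price $P=R_B/R_A$ of asset $A$ in units of asset $B$. For a trade, let $P'$ denote the pool price after the trade and call $|P-P'|$ its absolute price impact. Then for every quantity $q$ of asset $A$ with $0<q<R_A$, buying the quantity $q$ of $A$ from the pool causes a strictly higher absolute price impact $|P-P'|$ than selling the same quantity $q$ of $A$ to the pool.
   Context: In a constant-product pool the product of reserves is unchanged by a trade (fees do not enter the pool). Buying $q$ units of $A$ from the pool changes the $A$-reserve to $R_A-q$; selling $q$ units of $A$ to the pool changes it to $R_A+q$; in both cases the $B$-reserve adjusts so that the product of reserves remains $R_AR_B$. The pool price is the ratio ($B$-reserve)/($A$-reserve). *)

theory Defs
  imports Complex_Main
begin

record pool =
  reserve_A :: real
  reserve_B :: real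

text \<open>Price of asset A in units of asset B.\<close>

definition pool_price :: "pool \<Rightarrow> real" where
  "pool_price p = reserve_B p / reserve_A p"

text \<open>
  Trades are relations between the pool before and the pool after the trade: the A-reserve
  changes by the traded quantity and the B-reserve is whatever keeps the product of the
  reserves unchanged. Fees do not enter the pool. For positive reserves and
  \<open>0 < q < reserve_A p\<close> the pool after the trade exists and is unique; see
  \<open>buys_A_iff\<close> and \<open>sells_A_iff\<close>.
\<close>

definition buys_A :: "real \<Rightarrow> pool \<Rightarrow> pool \<Rightarrow> bool" where
  "buys_A q p p' \<longleftrightarrow>
     reserve_A p' = reserve_A p - q \<and>
     reserve_A p' * reserve_B p' = reserve_A p * reserve_B p"

definition sells_A :: "real \<Rightarrow> pool \<Rightarrow> pool \<Rightarrow> bool" where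
  "sells_A q p p' \<longleftrightarrow>
     reserve_A p' = reserve_A p + q \<and>
     reserve_A p' * reserve_B p' = reserve_A p * reserve_B p"

definition abs_price_impact :: "pool \<Rightarrow> pool \<Rightarrow> real" where
  "abs_price_impact p p' = \<bar>pool_price p - pool_price p'\<bar>"

lemma buys_A_iff:
  assumes "q < reserve_A p"
  shows "buys_A q p p' \<longleftrightarrow>
    p' = \<lparr>reserve_A = reserve_A p - q,
          reserve_B = reserve_A p * reserve_B p / (reserve_A p - q)\<rparr>"
  using assms by (cases p') (auto simp: buys_A_def eq_divide_eq mult.commute)

lemma sells_A_iff:
  assumes "0 < reserve_A p" and "0 < q"
  shows "sells_A q p p' \<longleftrightarrow>
    p' = \<lparr>reserve_A = reserve_A p + q,
          reserve_B = reserve_A p * reserve_B p / (reserve_A p + q)\<rparr>"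
  using assms by (cases p') (auto simp: sells_A_def eq_divide_eq mult.commute)

end

(* With k the invariant product, the pool price at A-reserve x is k / x^2, a strictly convex
   decreasing function of x; so a decrease of x by q moves it by more than an increase by q. *)
theory Submission
  imports Defs
begin

text \<open>Writing the price over the squared A-reserve (\<open>pool_price_eq\<close>) brings in
  the invariant product, so all three prices are values of k / x^2, at r, r - q and r + q. Convexity
  enters only at the midpoint r (\<open>inverse_square_midpoint_less\<close>): twice the old price
  is below the sum of the two new ones, so the rise from buying exceeds the fall from
  selling.\<close>

lemma pool_price_eq:
  assumes "reserve_A p \<noteq> 0"
  shows "pool_price p = reserve_A p * reserve_B p / (reserve_A p)\<^sup>2"
  using assms by (simp add: pool_price_def power2_eq_square)

text \<open>By AM-GM for 1 / (r - q) and 1 / (r + q), the right-hand side is at least 2 / (r^2 -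
  q^2), which exceeds 2 / r^2 because q > 0.\<close>

lemma inverse_square_midpoint_less:
  fixes r q :: real
  assumes "0 < q" and "q < r"
  shows "2 / r\<^sup>2 < 1 / (r - q)\<^sup>2 + 1 / (r + q)\<^sup>2"
proof -
  have pos: "0 < (r - q) * (r + q)"
    using assms by simp
  have "(r - q) * (r + q) < r\<^sup>2"
    using assms by (simp add: power2_eq_square algebra_simps)
  then have "2 / r\<^sup>2 < 2 / ((r - q) * (r + q))"
    using pos by (intro divide_strict_left_mono) (use assms in auto)
  also have "\<dots> = 2 * (1 / (r - q)) * (1 / (r + q))"
    by simp
  also have "\<dots> \<le> (1 / (r - q))\<^sup>2 + (1 / (r + q))\<^sup>2"
    by (rule sum_squares_bound)
  finally show ?thesis
    by (simp add: power_divide)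
qed

theorem proposition4p2:
  fixes p p_buy p_sell :: pool and q :: real
  assumes "0 < reserve_A p" and "0 < reserve_B p"
    and "0 < q" and "q < reserve_A p"
    and "buys_A q p p_buy"
    and "sells_A q p p_sell"
  shows "abs_price_impact p p_sell < abs_price_impact p p_buy"
proof -
  define r where "r = reserve_A p"
  define k where "k = r * reserve_B p"
  have r: "0 < q" "q < r" and k: "0 < k"
    using assms by (simp_all add: r_def k_def)
  have price: "pool_price p = k / r\<^sup>2"
    using assms(1) by (simp add: pool_price_eq r_def k_def)
  have price_buy: "pool_price p_buy = k / (r - q)\<^sup>2"
    using assms(4,5) by (auto simp: buys_A_def pool_price_eq r_def k_def)
  have price_sell: "pool_price p_sell = k / (r + q)\<^sup>2"
    using assms(1,3,6) by (auto simp: sells_A_def pool_price_eq r_def k_def)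
  have "k * (2 / r\<^sup>2) < k * (1 / (r - q)\<^sup>2 + 1 / (r + q)\<^sup>2)"
    using inverse_square_midpoint_less[OF r] k by (rule mult_strict_left_mono)
  then have convex: "2 * (k / r\<^sup>2) < k / (r - q)\<^sup>2 + k / (r + q)\<^sup>2"
    by (simp add: algebra_simps)
  \<comment> \<open>Selling lowers the price, which settles the sign inside the smaller impact; the
    larger one is bounded below by the price rise, since |x| \<ge> -x.\<close>
  have "k / (r + q)\<^sup>2 < k / r\<^sup>2"
    using r k by (intro divide_strict_left_mono power_strict_mono) auto
  with convex show ?thesis
    unfolding abs_price_impact_def price price_buy price_sell by linarith
qed

end
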